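(* Let $\phi$ be a Ma-Minda function with Taylor expansion $\phi(z)=1+\sum_{n=1}^{\infty}B_n z^n$ in $\mathbb{D}$, with $B_n>0$ for all $n\ge 1$, and suppose $\phi\in H^2$ (the Hardy class on $\mathbb{D}$). Let $f(z)=z+\sum_{n=2}^{\infty}a_nz^n$ belong to $\mathcal{S}^*(\phi)$. Then $$|z|+\sum_{n=2}^{\infty}|a_n||z|^n\le d(f(0),\partial f(\mathbb{D}))$$ for $|z|=r\le\min\{r_f,1/3\}$, where $r_f$ is the smallest positive root in $(0,1)$ of the equation $h(r)+h(-1)=0$.
   Context: $\mathbb{D}=\{z\in\mathbb{C}:|z|<1\}$. $\mathcal{A}$ is the class of analytic functions $f$ in $\mathbb{D}$ with $f(0)=0$, $f'(0)=1$, and $\mathcal{S}\subseteq\mathcal{A}$ is the subclass of univalent functions. For analytic $f,g$ in $\mathbb{D}$, $f\prec g$ (subordination) means $f=g\circ\omega$ for some analytic $\omega:\mathbb{D}\to\mathbb{D}$ with $\omega(0)=0$. A Ma-Minda function is an analytic univalent function $\phi$ on $\mathbb{D}$ such that $\phi(\mathbb{D})$ lies in the right half-plane (positive real part), is symmetric with respect to the real axis and starlike with respect to $\phi(0)=1$, and $\phi'(0)>0$. $\mathcal{S}^*(\phi)$ is the class of $f\in\mathcal{S}$ with $zf'(z)/f(z)\prec\phi(z)$. The function $h\in\mathcal{S}$ is determined by $zh'(z)/h(z)=\phi(z)$, $h(0)=0$, $h'(0)=1$, and $h(-1)$ denotes $\lim_{r\to1^-}h(-r)$. $d$ is Euclidean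 distance, so $d(f(0),\partial f(\mathbb{D}))$ is the distance from the point $f(0)$ to the boundary of $f(\mathbb{D})$. *)

theory Defs
  imports "HOL-Complex_Analysis.Complex_Analysis"
begin

abbreviation unit_disc :: "complex set" where
  "unit_disc \<equiv> ball 0 1"

definition class_A :: "(complex \<Rightarrow> complex) set" where
  "class_A = {f. f holomorphic_on unit_disc \<and> f 0 = 0 \<and> deriv f 0 = 1}"

definition class_S :: "(complex \<Rightarrow> complex) set" where
  "class_S = {f \<in> class_A. inj_on f unit_disc}"

definition subordinate :: "(complex \<Rightarrow> complex) \<Rightarrow> (complex \<Rightarrow> complex) \<Rightarrow> bool" where
  "subordinate f g \<longleftrightarrow>
     f holomorphic_on unit_disc \<and> g holomorphic_on unit_disc \<and>
     (\<exists>\<omega>. \<omega> holomorphic_on unit_disc \<and> \<omega> ` unit_disc \<subseteq> unit_disc \<and> \<omega> 0 = 0 \<and>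
          (\<forall>z\<in>unit_disc. f z = g (\<omega> z)))"

definition starlike_wrt :: "'a::real_vector \<Rightarrow> 'a set \<Rightarrow> bool" where
  "starlike_wrt c S \<longleftrightarrow> c \<in> S \<and> (\<forall>w\<in>S. closed_segment c w \<subseteq> S)"

definition ma_minda :: "(complex \<Rightarrow> complex) \<Rightarrow> bool" where
  "ma_minda \<phi> \<longleftrightarrow>
     \<phi> holomorphic_on unit_disc \<and> inj_on \<phi> unit_disc \<and>
     (\<forall>z\<in>unit_disc. Re (\<phi> z) > 0) \<and>
     cnj ` (\<phi> ` unit_disc) = \<phi> ` unit_disc \<and>
     \<phi> 0 = 1 \<and> starlike_wrt 1 (\<phi> ` unit_disc) \<and>
     deriv \<phi> 0 \<in> \<real> \<and> Re (deriv \<phi> 0) > 0"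

(* z f'(z) / f(z). For f in class_S the singularity at 0 is removable with value 1, whereas
   division by zero in HOL would give 0 there. *)
definition zlogderiv :: "(complex \<Rightarrow> complex) \<Rightarrow> complex \<Rightarrow> complex" where
  "zlogderiv f z = (if z = 0 then 1 else z * deriv f z / f z)"

definition ma_minda_starlike :: "(complex \<Rightarrow> complex) \<Rightarrow> (complex \<Rightarrow> complex) set" where
  "ma_minda_starlike \<phi> = {f \<in> class_S. subordinate (zlogderiv f) \<phi>}"

definition hardy_mean :: "real \<Rightarrow> (complex \<Rightarrow> complex) \<Rightarrow> real \<Rightarrow> real" where
  "hardy_mean p f r =
     (1 / (2 * pi) * integral {0..2 * pi} (\<lambda>t. cmod (f (of_real r * cis t)) powr p)) powr (1 / p)"

definition hardy_space :: "real \<Rightarrow> (complex \<Rightarrow> complex) set" where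
  "hardy_space p = {f. f holomorphic_on unit_disc \<and> bdd_above (hardy_mean p f ` {0<..<1})}"

definition value_at_minus_one :: "(complex \<Rightarrow> complex) \<Rightarrow> complex" where
  "value_at_minus_one h = Lim (at_left 1) (\<lambda>r::real. h (- of_real r))"

definition smallest_root_01 :: "(real \<Rightarrow> complex) \<Rightarrow> real \<Rightarrow> bool" where
  "smallest_root_01 g x \<longleftrightarrow>
     0 < x \<and> x < 1 \<and> g x = 0 \<and> (\<forall>y. 0 < y \<and> y < x \<longrightarrow> g y \<noteq> 0)"

end

theory Submission
  imports Defs
begin

text \<open>
  Write \<open>f = z exp F\<close> and \<open>h = z exp H\<close>, so that \<open>z F' = \<phi> \<circ> \<omega> - 1\<close> and \<open>z H' = \<phi> - 1\<close>, and let
  \<open>L = -h(-1)\<close>. Both sides of the claim are compared with \<open>L\<close>.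

  For the distance, a minimum principle gives \<open>Re F(z) \<ge> H(-|z|)\<close>, that is \<open>-h(-|z|) \<le> |f z|\<close>: it
  uses only that \<open>\<phi>\<close> is injective, commutes with conjugation and is increasing on the real diameter.
  Hence every boundary point of the image has modulus at least \<open>L\<close>.

  For the coefficient sum, Bohr's inequality bounds the majorant series of \<open>\<omega>\<close> by \<open>r\<close> when
  \<open>r \<le> 1/3\<close>. Since \<open>B\<^sub>n > 0\<close> and majorants are submultiplicative, the majorant of \<open>\<phi> \<circ> \<omega>\<close> is at
  most \<open>\<phi> r\<close>, and the equation \<open>z f' = f (\<phi> \<circ> \<omega>)\<close> then bounds the majorant of \<open>f\<close> by \<open>h r\<close>. As \<open>h\<close>
  increases on \<open>[0,1)\<close>, \<open>h r \<le> L\<close> for \<open>r\<close> up to the root.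
\<close>

subsection \<open>Bohr's inequality\<close>

text \<open>Cauchy's formula for the \<open>k\<close>-th derivative on the circle of radius
  \<open>\<rho>\<close>, multiplied by \<open>\<rho> ^ k / (2 * pi * \<i>)\<close>. The parameter
  runs over [0,1] because that of \<open>circlepath\<close> does.\<close>

lemma has_integral_circle_coeff:
  assumes G: "G holomorphic_on unit_disc" and \<rho>: "0 < \<rho>" "\<rho> < 1"
  shows "((\<lambda>t. G (of_real \<rho> * cis (2 * pi * t)) * cis (- (2 * pi * real k * t)))
           has_integral of_real \<rho> ^ k * fps_nth (fps_expansion G 0) k) {0..1}"
proof -
  have sub: "cball 0 \<rho> \<subseteq> unit_disc" using \<rho> by auto
  have "((\<lambda>u. G u / (u - 0) ^ Suc k) has_contour_integral
           (2 * pi * \<i>) / fact k * (deriv ^^ k) G 0) (circlepath 0 \<rho>)"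
    using \<rho> sub G
    by (intro Cauchy_has_contour_integral_higher_derivative_circlepath)
       (auto intro: holomorphic_on_imp_continuous_on holomorphic_on_subset)
  then have I: "((\<lambda>t. G (circlepath 0 \<rho> t) / circlepath 0 \<rho> t ^ Suc k
                  * vector_derivative (circlepath 0 \<rho>) (at t))
          has_integral (2 * pi * \<i>) / fact k * (deriv ^^ k) G 0) {0..1}"
    by (simp add: has_contour_integral)
  have eq: "of_real \<rho> ^ k / (2 * pi * \<i>) * (G (circlepath 0 \<rho> t) / circlepath 0 \<rho> t ^ Suc k
                  * vector_derivative (circlepath 0 \<rho>) (at t))
        = G (of_real \<rho> * cis (2 * pi * t)) * cis (- (2 * pi * real k * t))" for t
  proof -
    define e where "e = cis (2 * pi * t)"
    have e: "e \<noteq> 0" "circlepath 0 \<rho> t = of_real \<rho> * e"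
      "vector_derivative (circlepath 0 \<rho>) (at t) = 2 * pi * \<i> * (of_real \<rho> * e)"
      by (simp_all only: e_def vector_derivative_circlepath)
         (simp_all add: circlepath cis_conv_exp mult_ac)
    have "2 * pi * real k * t = real k * (2 * pi * t)"
      by (simp add: mult_ac)
    then have inv: "cis (- (2 * pi * real k * t)) = inverse (e ^ k)"
      by (simp only: e_def Complex.DeMoivre cis_inverse)
    have "r ^ k / p * (g / (r * e) ^ Suc k * (p * (r * e))) = g * inverse (e ^ k)"
      if "r \<noteq> 0" "p \<noteq> 0" for r p g :: complex
      using that e(1) by (simp add: power_mult_distrib divide_simps)
    from this[of "of_real \<rho>" "2 * pi * \<i>" "G (of_real \<rho> * e)"] show ?thesis
      unfolding e inv using \<rho> by (simp add: e_def)
  qed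
  have "((\<lambda>t. of_real \<rho> ^ k / (2 * pi * \<i>) * (G (circlepath 0 \<rho> t) / circlepath 0 \<rho> t ^ Suc k
                  * vector_derivative (circlepath 0 \<rho>) (at t)))
          has_integral of_real \<rho> ^ k / (2 * pi * \<i>) * ((2 * pi * \<i>) / fact k * (deriv ^^ k) G 0)) {0..1}"
    by (rule has_integral_mult_right[OF I])
  then show ?thesis
    unfolding eq by (simp add: fps_expansion_def field_simps)
qed

text \<open>The real part is half the sum of a negative and a positive frequency. The constant 1
  contributes \<open>G 0\<close>, the negative frequency extracts the \<open>n\<close>-th
  coefficient, and the positive one integrates to 0.\<close>

lemma has_integral_circle_kernel:
  assumes G: "G holomorphic_on unit_disc" and \<rho>: "0 < \<rho>" "\<rho> < 1" and n: "n > 0"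
  shows "((\<lambda>t. G (of_real \<rho> * cis (2 * pi * t)) * of_real (1 + Re (\<eta> * cis (- (2 * pi * real n * t)))))
           has_integral G 0 + \<eta> * of_real \<rho> ^ n * fps_nth (fps_expansion G 0) n / 2) {0..1}"
proof -
  have I0: "((\<lambda>t. G (of_real \<rho> * cis (2 * pi * t))) has_integral G 0) {0..1}"
    using has_integral_circle_coeff[OF G \<rho>, of 0] by (simp add: fps_expansion_def)
  note In = has_integral_circle_coeff[OF G \<rho>, of n]
  \<comment> \<open>Up to the factor \<open>\<rho> ^ n\<close>, the positive frequency gives the
    mean of \<open>G u * u ^ n\<close>, which is zero at the centre because
    \<open>n > 0\<close>.\<close>
  have "(\<lambda>u. G u * u ^ n) holomorphic_on unit_disc"
    by (intro holomorphic_intros G)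
  from has_integral_circle_coeff[OF this \<rho>, of 0]
  have "((\<lambda>t. G (of_real \<rho> * cis (2 * pi * t)) * (of_real \<rho> * cis (2 * pi * t)) ^ n) has_integral 0) {0..1}"
    using n by (simp add: fps_expansion_def power_0_left)
  note Im0 = has_integral_mult_right[OF this, of "inverse (of_real \<rho> ^ n)"]
  have pw: "cis (2 * pi * t) ^ n = cis (2 * pi * real n * t)" for t
    using Complex.DeMoivre[of "2 * pi * t" n] by (metis mult.assoc mult.commute)
  have scale: "inverse (of_real \<rho> ^ n) * (G x * (of_real \<rho> * y) ^ n) = G x * y ^ n" for x y :: complex
    using \<rho> by (simp add: power_mult_distrib)
  from Im0 have Im: "((\<lambda>t. G (of_real \<rho> * cis (2 * pi * t)) * cis (2 * pi * real n * t)) has_integral 0) {0..1}"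
    unfolding scale pw by simp
  have eq: "g + (\<eta>/2) * (g * cis (- s)) + (cnj \<eta>/2) * (g * cis s)
          = g * of_real (1 + Re (\<eta> * cis (- s)))" for g s
  proof -
    have "of_real (Re (\<eta> * cis (- s))) = (\<eta> * cis (- s) + cnj (\<eta> * cis (- s))) / 2"
      by (subst complex_add_cnj) simp
    also have "cnj (\<eta> * cis (- s)) = cnj \<eta> * cis s"
      by (simp add: cis_cnj)
    finally show ?thesis
      by (simp add: algebra_simps add_divide_distrib)
  qed
  show ?thesis
    using has_integral_add[OF has_integral_add[OF I0 has_integral_mult_right[OF In, of "\<eta>/2"]]
        has_integral_mult_right[OF Im, of "cnj \<eta>/2"]]
    unfolding eq by (simp add: mult_ac)
qed

text \<open>The kernel \<open>1 + Re (\<eta> cis (- n s))\<close> is nonnegative with mean value 1, so its integral against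
  \<open>G\<close> stays in the unit disc; the phase of \<open>\<eta>\<close> aligns the two surviving coefficients.\<close>

lemma bounded_coeff_le:
  assumes G: "G holomorphic_on unit_disc" and le: "\<And>z. z \<in> unit_disc \<Longrightarrow> cmod (G z) \<le> 1"
    and n: "n > 0"
  shows "cmod (fps_nth (fps_expansion G 0) n) \<le> 2 * (1 - cmod (G 0))"
proof -
  define c where "c = fps_nth (fps_expansion G 0) n"
  \<comment> \<open>Since \<open>sgn 0 = 0\<close>, the vanishing cases get the value 1, which keeps
    \<open>u\<close> and \<open>\<eta>\<close> unimodular.\<close>
  define u where "u = (if G 0 = 0 then 1 else sgn (G 0))"
  define \<eta> where "\<eta> = (if c = 0 then 1 else u * cnj (sgn c))"
  have u: "cmod u = 1" "G 0 = u * cmod (G 0)"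
    by (auto simp: u_def norm_sgn) (simp add: sgn_eq)
  have \<eta>: "cmod \<eta> = 1"
    using u(1) by (auto simp: \<eta>_def norm_mult norm_sgn)
  have \<eta>c: "\<eta> * c = u * cmod c"
  proof (cases "c = 0")
    case False
    have "cnj c * c = of_real (cmod c) * of_real (cmod c)"
      using complex_norm_square[of c] by (simp add: power2_eq_square mult.commute)
    then show ?thesis
      using False by (simp add: \<eta>_def sgn_eq mult.assoc)
  qed simp
  have ineq: "cmod (G 0) + \<rho> ^ n * cmod c / 2 \<le> 1" if \<rho>: "0 < \<rho>" "\<rho> < 1" for \<rho>
  proof -
    let ?K = "\<lambda>t. 1 + Re (\<eta> * cis (- (2 * pi * real n * t)))"
    have K0: "?K t \<ge> 0" for t
      using abs_Re_le_cmod[of "\<eta> * cis (- (2 * pi * real n * t))"] \<eta>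
      by (simp add: norm_mult abs_le_iff del: times_complex.sel)
    note IG = has_integral_circle_kernel[OF G \<rho> n, of \<eta>]
    \<comment> \<open>The mean value of the kernel comes from the same formula, applied to the
      constant function 1.\<close>
    have "((\<lambda>t. of_real (?K t)) has_integral (1::complex)) {0..1}"
      using has_integral_circle_kernel[of "\<lambda>_. 1", OF _ \<rho> n, of \<eta>] n
      by (simp add: fps_expansion_def)
    from has_integral_Re[OF this] have IK: "(?K has_integral 1) {0..1}"
      by (simp only: Re_complex_of_real one_complex.sel)
    have "cmod (integral {0..1} (\<lambda>t. G (of_real \<rho> * cis (2 * pi * t)) * of_real (?K t)))
            \<le> integral {0..1} ?K"
    proof (rule integral_norm_bound_integral)
      fix t :: real
      have "cmod (G (of_real \<rho> * cis (2 * pi * t))) * ?K t \<le> 1 * ?K t"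
        using \<rho> by (intro mult_right_mono le K0) (auto simp: norm_mult)
      moreover have "cmod (of_real (?K t)) = ?K t"
        using K0[of t] by (simp del: times_complex.sel of_real_add)
      ultimately show "cmod (G (of_real \<rho> * cis (2 * pi * t)) * of_real (?K t)) \<le> ?K t"
        by (simp add: norm_mult del: times_complex.sel of_real_add)
    qed (use IG IK in \<open>blast intro: has_integral_integrable\<close>)+
    then have "cmod (G 0 + \<eta> * of_real \<rho> ^ n * c / 2) \<le> 1"
      unfolding integral_unique[OF IG] integral_unique[OF IK] c_def .
    moreover have "G 0 + \<eta> * of_real \<rho> ^ n * c / 2 = u * of_real (cmod (G 0) + \<rho> ^ n * cmod c / 2)"
      by (subst u(2)) (use \<eta>c in \<open>simp add: algebra_simps\<close>)
    ultimately show ?thesis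
      using u(1) \<rho> by (simp add: norm_mult abs_of_nonneg del: of_real_add)
  qed
  \<comment> \<open>Letting \<open>\<rho>\<close> tend to 1 leaves |G(0)| + |c|/2 at most 1, the
    source of the factor 2.\<close>
  have "((\<lambda>\<rho>. cmod (G 0) + \<rho> ^ n * cmod c / 2) \<longlongrightarrow> cmod (G 0) + 1 ^ n * cmod c / 2) (at_left (1::real))"
    by (intro tendsto_intros) auto
  then have "cmod (G 0) + 1 ^ n * cmod c / 2 \<le> 1"
  proof (rule tendsto_upperbound)
    show "\<forall>\<^sub>F \<rho> in at_left 1. cmod (G 0) + \<rho> ^ n * cmod c / 2 \<le> 1"
      using eventually_at_left_real[OF zero_less_one] by eventually_elim (use ineq in auto)
  qed auto
  then show ?thesis by (simp add: c_def)
qed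

section \<open>Majorants of formal power series\<close>

text \<open>Truncating at \<open>N\<close> keeps all manipulations finite. The bounds are uniform in
  \<open>N\<close>, so summability of the coefficient series of \<open>f\<close> follows from them
  at the end.\<close>

definition fps_majorant :: "nat \<Rightarrow> real \<Rightarrow> complex fps \<Rightarrow> real" where
  "fps_majorant N r F = (\<Sum>m\<le>N. cmod (fps_nth F m) * r ^ m)"

lemma fps_majorant_nonneg: "r \<ge> 0 \<Longrightarrow> fps_majorant N r F \<ge> 0"
  unfolding fps_majorant_def by (intro sum_nonneg) auto

text \<open>Coefficients of degree at most \<open>N\<close> in the product involve only index pairs
  in a triangle, which lies inside the square of pairs coming from the two truncations.\<close>

lemma fps_majorant_mult:
  assumes r: "r \<ge> 0"
  shows "fps_majorant N r (F * G) \<le> fps_majorant N r F * fps_majorant N r G"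
proof -
  let ?f = "\<lambda>i j. cmod (fps_nth F i) * r ^ i * (cmod (fps_nth G j) * r ^ j)"
  have "fps_majorant N r (F * G) \<le> (\<Sum>m\<le>N. \<Sum>i\<le>m. ?f i (m - i))"
    unfolding fps_majorant_def
  proof (intro sum_mono)
    fix m
    have "cmod (fps_nth (F * G) m) * r ^ m \<le> (\<Sum>i\<le>m. cmod (fps_nth F i) * cmod (fps_nth G (m - i))) * r ^ m"
      unfolding fps_mult_nth atLeast0AtMost
      by (intro mult_right_mono norm_sum[THEN order_trans]) (auto simp: norm_mult r)
    also have "\<dots> = (\<Sum>i\<le>m. ?f i (m - i))"
      unfolding sum_distrib_right
      by (intro sum.cong refl) (simp add: mult_ac flip: power_add)
    finally show "cmod (fps_nth (F * G) m) * r ^ m \<le> (\<Sum>i\<le>m. ?f i (m - i))" .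
  qed
  also have "\<dots> = (\<Sum>(i, j)\<in>{(i, j). i + j \<le> N}. ?f i j)"
    by (rule sum.triangle_reindex_eq[symmetric])
  also have "\<dots> \<le> (\<Sum>(i, j)\<in>{..N} \<times> {..N}. ?f i j)"
    by (intro sum_mono2) (use r in auto)
  also have "\<dots> = fps_majorant N r F * fps_majorant N r G"
    by (simp add: fps_majorant_def sum_product sum.cartesian_product)
  finally show ?thesis .
qed

lemma fps_majorant_power_le:
  assumes r: "r \<ge> 0" and W: "fps_majorant N r W \<le> c"
  shows "fps_majorant N r (W ^ n) \<le> c ^ n"
proof (induction n)
  case 0
  have "fps_majorant N r 1 = (\<Sum>m\<le>N. if m = 0 then 1 else 0)"
    unfolding fps_majorant_def by (intro sum.cong) auto
  then show ?case by simp
next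
  case (Suc n)
  have "fps_majorant N r (W * W ^ n) \<le> fps_majorant N r W * fps_majorant N r (W ^ n)"
    by (rule fps_majorant_mult[OF r])
  also have "\<dots> \<le> c * c ^ n"
    using Suc W fps_majorant_nonneg[OF r] order_trans by (intro mult_mono) blast+
  finally show ?case by simp
qed

text \<open>The composite is a combination of powers of \<open>W\<close>, and submultiplicativity
  bounds the majorant of \<open>W ^ i\<close> by \<open>c ^ i\<close>.\<close>

lemma fps_majorant_compose:
  assumes r: "r \<ge> 0" and W: "fps_majorant N r W \<le> c"
  shows "fps_majorant N r (A oo W) \<le> fps_majorant N c A"
proof -
  have "fps_majorant N r (A oo W) \<le> (\<Sum>m\<le>N. \<Sum>i\<le>N. cmod (fps_nth A i) * (cmod (fps_nth (W ^ i) m) * r ^ m))"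
    unfolding fps_majorant_def
  proof (intro sum_mono)
    fix m assume m: "m \<in> {..N}"
    have "cmod (fps_nth (A oo W) m) \<le> (\<Sum>i\<le>m. cmod (fps_nth A i) * cmod (fps_nth (W ^ i) m))"
      unfolding fps_compose_nth atLeast0AtMost by (rule norm_sum[THEN order_trans]) (simp add: norm_mult)
    \<comment> \<open>Adding the nonnegative terms with \<open>i > m\<close> makes the range
      independent of \<open>m\<close>, so that the two sums can be swapped.\<close>
    also have "\<dots> \<le> (\<Sum>i\<le>N. cmod (fps_nth A i) * cmod (fps_nth (W ^ i) m))"
      using m by (intro sum_mono2) auto
    finally have "cmod (fps_nth (A oo W) m) * r ^ m
        \<le> (\<Sum>i\<le>N. cmod (fps_nth A i) * cmod (fps_nth (W ^ i) m)) * r ^ m"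
      using r by (intro mult_right_mono) auto
    then show "cmod (fps_nth (A oo W) m) * r ^ m
        \<le> (\<Sum>i\<le>N. cmod (fps_nth A i) * (cmod (fps_nth (W ^ i) m) * r ^ m))"
      by (simp add: sum_distrib_right mult.assoc)
  qed
  also have "\<dots> = (\<Sum>i\<le>N. cmod (fps_nth A i) * fps_majorant N r (W ^ i))"
    unfolding fps_majorant_def sum_distrib_left by (rule sum.swap)
  also have "\<dots> \<le> (\<Sum>i\<le>N. cmod (fps_nth A i) * c ^ i)"
    by (intro sum_mono mult_left_mono fps_majorant_power_le[OF r W]) auto
  finally show ?thesis by (simp add: fps_majorant_def)
qed

text \<open>At \<open>r = 1/3\<close> the powers \<open>r ^ m\<close> with \<open>m \<ge> 1\<close>
  sum to 1/2, which cancels the 2 in \<open>bounded_coeff_le\<close>. The tail is then at most 1 -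
  |G(0)|.\<close>

lemma Bohr_inequality:
  assumes G: "G holomorphic_on unit_disc" and le: "\<And>z. z \<in> unit_disc \<Longrightarrow> cmod (G z) \<le> 1"
    and r: "0 \<le> r" "r \<le> 1 / 3"
  shows "fps_majorant N r (fps_expansion G 0) \<le> 1"
proof -
  define d where "d = 1 - cmod (G 0)"
  have d: "d \<ge> 0" using le[of 0] by (simp add: d_def)
  have geo: "(\<Sum>m<N. (1/3 :: real) ^ Suc m) = (1 - (1/3) ^ N) / 2"
    by (induction N) (simp_all add: diff_divide_distrib)
  have "(\<Sum>m<N. cmod (fps_nth (fps_expansion G 0) (Suc m)) * r ^ Suc m) \<le> (\<Sum>m<N. 2 * d * (1/3) ^ Suc m)"
    unfolding d_def by (intro sum_mono mult_mono bounded_coeff_le[OF G le] power_mono r) (use le[of 0] r in auto)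
  also have "\<dots> = 2 * d * ((1 - (1/3) ^ N) / 2)"
    unfolding geo[symmetric] by (simp only: sum_distrib_left)
  also have "\<dots> \<le> d"
    using d by (simp add: field_simps)
  finally show ?thesis
    by (simp add: fps_majorant_def sum.atMost_shift d_def fps_expansion_def)
qed

lemma fps_majorant_X_le:
  assumes r: "r \<ge> 0"
  shows "fps_majorant N r fps_X \<le> r"
proof -
  have "fps_majorant N r fps_X = (\<Sum>m\<le>N. if m = 1 then r else 0)"
    unfolding fps_majorant_def by (intro sum.cong) auto
  also have "\<dots> \<le> r" using r by simp
  finally show ?thesis .
qed

text \<open>By Schwarz's lemma \<open>\<omega> z / z\<close> extends to a function bounded by 1, to
  which Bohr's inequality applies. Restoring the factor \<open>z\<close> costs at most a factor
  \<open>r\<close>.\<close>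

lemma Bohr_inequality_Schwarz:
  assumes \<omega>: "\<omega> holomorphic_on unit_disc" "\<omega> ` unit_disc \<subseteq> unit_disc" "\<omega> 0 = 0"
    and r: "0 \<le> r" "r \<le> 1 / 3"
  shows "fps_majorant N r (fps_expansion \<omega> 0) \<le> r"
proof -
  obtain \<psi> where \<psi>: "\<psi> holomorphic_on unit_disc" "\<And>z. norm z < 1 \<Longrightarrow> \<omega> z = z * \<psi> z" "deriv \<omega> 0 = \<psi> 0"
    using Schwarz3[OF \<omega>(1,3)] by metis
  have no: "norm (\<omega> z) < 1" if "norm z < 1" for z
    using \<omega>(2) that by (auto simp: image_subset_iff)
  have le: "cmod (\<psi> z) \<le> 1" if z: "z \<in> unit_disc" for z
  proof (cases "z = 0")
    case True
    then show ?thesis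
      using Schwarz_Lemma(2)[OF \<omega>(1,3) no, of 0] \<psi>(3) by simp
  next
    case False
    then show ?thesis
      using Schwarz_Lemma(1)[OF \<omega>(1,3) no, of z] \<psi>(2)[of z] z by (simp add: norm_mult)
  qed
  have "(\<lambda>z. z * \<psi> z) has_fps_expansion fps_X * fps_expansion \<psi> 0"
    by (intro fps_expansion_intros has_fps_expansion_fps_expansion[of unit_disc] \<psi>) auto
  moreover have "\<forall>\<^sub>F z in nhds 0. z * \<psi> z = \<omega> z"
    using eventually_nhds_in_open[of unit_disc 0] by (rule eventually_mono) (auto simp: \<psi>(2))
  ultimately have "\<omega> has_fps_expansion fps_X * fps_expansion \<psi> 0"
    using has_fps_expansion_cong[OF _ refl] by metis
  then have "fps_expansion \<omega> 0 = fps_X * fps_expansion \<psi> 0"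
    by (rule fps_expansion_eqI)
  then have "fps_majorant N r (fps_expansion \<omega> 0)
      \<le> fps_majorant N r fps_X * fps_majorant N r (fps_expansion \<psi> 0)"
    using fps_majorant_mult[OF r(1)] by simp
  also have "\<dots> \<le> r * 1"
    by (intro mult_mono fps_majorant_X_le Bohr_inequality \<psi>(1) le fps_majorant_nonneg r)
  finally show ?thesis by simp
qed

text \<open>\<open>e\<close> plays the role of \<open>\<eta>'\<close>. With \<open>Q = M/x\<close>, where \<open>M\<close> is the majorant polynomial of \<open>F\<close>, the
  equation for \<open>F\<close> gives \<open>Q' \<le> Q \<eta>'\<close>, so \<open>Q exp (- \<eta>)\<close> decreases from the value 1.\<close>

lemma fps_majorant_le_exp:
  fixes F G :: "complex fps" and \<eta> e p :: "real \<Rightarrow> real"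
  assumes F: "fps_nth F 0 = 0" "fps_nth F 1 = 1" and FG: "fps_X * fps_deriv F = F * G"
    and G: "\<And>x N. 0 < x \<Longrightarrow> x < r \<Longrightarrow> fps_majorant N x G \<le> 1 + x * e x"
    and \<eta>: "\<And>x. 0 < x \<Longrightarrow> x < r \<Longrightarrow> (\<eta> has_real_derivative e x) (at x)"
    and cont: "continuous_on {0..r} \<eta>" and \<eta>0: "\<eta> 0 = 0" and r: "0 \<le> r"
  shows "fps_majorant (Suc N) r F \<le> r * exp (\<eta> r)"
proof -
  \<comment> \<open>The quotient is written as a polynomial so that it makes sense at 0, where it
    equals \<open>cmod (fps_nth F 1) = 1\<close>.\<close>
  define Q where "Q x = (\<Sum>n\<le>N. cmod (fps_nth F (Suc n)) * x ^ n)" for x :: real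
  define Q' where "Q' x = (\<Sum>n\<le>N. cmod (fps_nth F (Suc n)) * (real n * x ^ (n - 1)))" for x :: real
  have FQ: "fps_majorant (Suc N) x F = x * Q x" for x
    unfolding fps_majorant_def sum.atMost_Suc_shift Q_def sum_distrib_left by (simp add: F mult_ac)
  have Q': "(Q has_real_derivative Q' x) (at x)" for x
    unfolding Q_def Q'_def by (auto intro!: derivative_eq_intros sum.cong)
  have le: "Q' x \<le> Q x * e x" if x: "0 < x" "x < r" for x
  proof -
    \<comment> \<open>The majorant of \<open>z F'\<close> is \<open>x (x Q)'\<close>. Comparing it
      with the product bound \<open>x Q (1 + x e)\<close> leaves
      \<open>Q' \<le> Q e\<close>.\<close>
    have "fps_majorant (Suc N) x (fps_X * fps_deriv F) = (\<Sum>n\<le>N. cmod (fps_nth F (Suc n)) * real (Suc n) * x ^ Suc n)"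
      unfolding fps_majorant_def sum.atMost_Suc_shift
      by (simp add: norm_mult mult_ac del: of_nat_Suc)
    also have "\<dots> = x * (x * Q' x + Q x)"
    proof -
      have "real (Suc n) * x ^ Suc n = x * (x * (real n * x ^ (n - 1)) + x ^ n)" for n
        by (cases n) (auto simp: algebra_simps)
      then show ?thesis
        unfolding Q_def Q'_def sum_distrib_left sum.distrib[symmetric]
        by (intro sum.cong refl) (metis (no_types, lifting) distrib_left mult.assoc mult.left_commute)
    qed
    finally have "x * (x * Q' x + Q x) \<le> x * Q x * fps_majorant (Suc N) x G"
      using fps_majorant_mult[of x "Suc N" F G] x FQ unfolding FG by simp
    also have "\<dots> \<le> x * Q x * (1 + x * e x)"
      by (intro mult_left_mono G x) (use x FQ[of x] fps_majorant_nonneg[of x "Suc N" F] in auto)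
    finally have "x * x * Q' x \<le> x * x * (Q x * e x)"
      by (simp add: algebra_simps)
    then show ?thesis using x by (simp add: mult_le_cancel_left_pos)
  qed
  have "Q 0 * exp (- \<eta> 0) \<ge> Q r * exp (- \<eta> r)"
  proof (rule DERIV_nonpos_imp_decreasing_open[OF r])
    fix x assume x: "0 < x" "x < r"
    have "((\<lambda>x. Q x * exp (- \<eta> x)) has_real_derivative (Q' x - Q x * e x) * exp (- \<eta> x)) (at x)"
      by (rule derivative_eq_intros Q' \<eta> x refl)+ (simp add: algebra_simps)
    then show "\<exists>y. ((\<lambda>x. Q x * exp (- \<eta> x)) has_real_derivative y) (at x) \<and> y \<le> 0"
      using le[OF x] by (intro exI conjI) (auto simp: mult_le_0_iff)
  next
    have "continuous_on {0..r} Q"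
      unfolding Q_def by (intro continuous_intros)
    then show "continuous_on {0..r} (\<lambda>x. Q x * exp (- \<eta> x))"
      by (intro continuous_intros cont)
  qed
  moreover have "Q 0 = 1"
    using F by (simp add: Q_def power_0_left if_distrib cong: if_cong)
  ultimately have "Q r \<le> exp (\<eta> r)"
    using \<eta>0 by (simp add: exp_minus field_simps)
  then show ?thesis
    using FQ[of r] r by (simp add: mult_left_mono)
qed

subsection \<open>Growth of starlike functions\<close>

text \<open>Injectivity and \<open>f' 0 = 1\<close> make \<open>f z / z\<close> zero-free on the
  disc, where it therefore has a logarithm. Logarithmic differentiation gives the second
  identity.\<close>

lemma class_S_exp_representation:
  assumes "f \<in> class_S"
  shows "\<exists>F. F holomorphic_on unit_disc \<and> F 0 = 0 \<and>
           (\<forall>z\<in>unit_disc. f z = z * exp (F z) \<and> z * deriv F z = zlogderiv f z - 1)"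
proof -
  have f: "f holomorphic_on unit_disc" "f 0 = 0" "deriv f 0 = 1" "inj_on f unit_disc"
    using assms by (auto simp: class_S_def class_A_def)
  obtain f1 where f1: "f1 holomorphic_on unit_disc" "\<And>z. norm z < 1 \<Longrightarrow> f z = z * f1 z" "deriv f 0 = f1 0"
    using Schwarz3[OF f(1,2)] by metis
  have "f1 z \<noteq> 0" if "z \<in> unit_disc" for z
  proof (cases "z = 0")
    case False
    then have "f z \<noteq> f 0"
      using inj_onD[OF f(4)] that by force
    then show ?thesis
      using f1(2)[of z] that f(2) by auto
  qed (use f1 f in auto)
  then obtain G where G: "G holomorphic_on unit_disc" "\<And>z. z \<in> unit_disc \<Longrightarrow> exp (G z) = f1 z"
    using holomorphic_logarithm_exists[OF convex_ball open_ball f1(1), of 0] by auto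
  \<comment> \<open>The shift leaves the exponential unchanged, because
    \<open>exp (G 0) = f' 0 = 1\<close>.\<close>
  define F where "F z = G z - G 0" for z
  have hF: "F holomorphic_on unit_disc"
    unfolding F_def by (intro holomorphic_intros G)
  have "exp (G 0) = 1"
    using G(2)[of 0] f1(3) f(3) by simp
  then have rep: "f z = z * exp (F z)" if "z \<in> unit_disc" for z
    using that f1(2)[of z] G(2)[of z] by (simp add: F_def exp_diff)
  have "z * deriv F z = zlogderiv f z - 1" if z: "z \<in> unit_disc" for z
  proof (cases "z = 0")
    case False
    have F': "(F has_field_derivative deriv F z) (at z)"
      using hF z by (auto intro: holomorphic_derivI)
    have "((\<lambda>z. z * exp (F z)) has_field_derivative exp (F z) * (1 + z * deriv F z)) (at z)"
      by (rule derivative_eq_intros F' refl)+ (simp add: algebra_simps)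
    then have "(f has_field_derivative exp (F z) * (1 + z * deriv F z)) (at z)"
      by (rule has_field_derivative_transform_within_open[of _ _ _ unit_disc]) (use rep z in auto)
    then have "deriv f z = exp (F z) * (1 + z * deriv F z)"
      by (rule DERIV_imp_deriv)
    then show ?thesis
      using False rep[OF z] by (simp add: zlogderiv_def field_simps)
  qed (simp add: zlogderiv_def)
  moreover have "F 0 = 0" by (simp add: F_def)
  ultimately show ?thesis
    using hF rep by blast
qed

text \<open>At a minimum of \<open>Re F(z) - Re H(-|z|) + e |z|\<close> away from 0 the tangential derivative
  \<open>- Im (z F'(z))\<close> vanishes. So \<open>\<phi> (\<omega> z)\<close> is real, hence \<open>\<omega> z\<close> is real and \<open>Re (\<phi> (\<omega> z)) \<ge> \<phi>(-|z|)\<close>,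
  which makes the radial derivative positive: a contradiction.\<close>

lemma Re_log_lower_bound:
  fixes \<phi> \<omega> F H :: "complex \<Rightarrow> complex"
  assumes F: "F holomorphic_on unit_disc" "F 0 = 0"
    and F': "\<And>z. z \<in> unit_disc \<Longrightarrow> z * deriv F z = \<phi> (\<omega> z) - 1"
    and H: "H holomorphic_on unit_disc" "H 0 = 0"
    and H': "\<And>z. z \<in> unit_disc \<Longrightarrow> z * deriv H z = \<phi> z - 1"
    and \<omega>: "\<And>z. z \<in> unit_disc \<Longrightarrow> cmod (\<omega> z) \<le> cmod z"
    and inj: "inj_on \<phi> unit_disc"
    and cnj: "\<And>z. z \<in> unit_disc \<Longrightarrow> \<phi> (cnj z) = cnj (\<phi> z)"
    and mono: "\<And>x \<rho>. \<bar>x\<bar> \<le> \<rho> \<Longrightarrow> \<rho> < 1 \<Longrightarrow>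
                 Re (\<phi> (- complex_of_real \<rho>)) \<le> Re (\<phi> (of_real x))"
    and z: "z \<in> unit_disc"
  shows "Re (H (- of_real (cmod z))) \<le> Re (F z)"
proof (rule field_le_epsilon)
  fix e :: real assume "e > 0"
  \<comment> \<open>The term \<open>e * cmod w\<close> makes the radial derivative strictly positive
    even where the other two terms balance; \<open>field_le_epsilon\<close> removes it.\<close>
  define v where "v w = Re (F w) - Re (H (- of_real (cmod w))) + e * cmod w" for w
  define R where "R = cmod z"
  have R: "0 \<le> R" "R < 1" using z by (auto simp: R_def)
  have sub: "cball 0 R \<subseteq> unit_disc" using R by auto
  have cF: "continuous_on (cball 0 R) F"
    using F(1) sub holomorphic_on_imp_continuous_on holomorphic_on_subset by blast
  have cH: "continuous_on (cball 0 R) (\<lambda>w. H (- of_real (cmod w)))"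
    by (rule continuous_on_compose2[OF holomorphic_on_imp_continuous_on[OF H(1)]])
       (use R in \<open>auto intro!: continuous_intros\<close>)
  have "continuous_on (cball 0 R) v"
    unfolding v_def by (intro continuous_intros cF cH)
  then obtain z0 where z0: "z0 \<in> cball 0 R" "\<And>w. w \<in> cball 0 R \<Longrightarrow> v z0 \<le> v w"
    using continuous_attains_inf[of "cball 0 R" v] R by auto
  define \<rho> where "\<rho> = cmod z0"
  have \<rho>: "\<rho> \<le> R" "\<rho> < 1" using z0 R by (auto simp: \<rho>_def)
  have z0D: "z0 \<in> unit_disc" using z0 sub by auto
  have "z0 = 0"
  proof (rule ccontr)
    assume "z0 \<noteq> 0"
    then have \<rho>0: "\<rho> > 0" by (simp add: \<rho>_def)
    have dF: "(F has_field_derivative deriv F z0) (at z0)"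
      using F(1) z0D by (auto intro: holomorphic_derivI)
    have dH: "(H has_field_derivative deriv H (- of_real \<rho>)) (at (- of_real \<rho>))"
      using H(1) \<rho> \<rho>0 by (auto intro!: holomorphic_derivI[of _ unit_disc])
    \<comment> \<open>Rotating \<open>z0\<close> fixes its modulus, so only \<open>Re F\<close>
      varies in \<open>v\<close>; its derivative in the angle must vanish at the minimum.\<close>
    have "((\<lambda>w. F (z0 * exp (\<i> * w))) has_field_derivative deriv F z0 * (\<i> * z0)) (at (of_real 0))"
      by (rule DERIV_chain2[of F]) (use dF in \<open>auto intro!: derivative_eq_intros\<close>)
    then have "((\<lambda>s. F (z0 * cis s)) has_vector_derivative (\<i> * z0) * deriv F z0) (at 0)"
      unfolding cis_conv_exp by (drule_tac has_vector_derivative_real_field) (simp add: mult_ac)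
    then have "((\<lambda>s. Re (F (z0 * cis s))) has_real_derivative - Im (z0 * deriv F z0)) (at 0)"
      unfolding has_real_derivative_iff_has_vector_derivative
      by (drule_tac bounded_linear.has_vector_derivative[OF bounded_linear_Re])
         (simp add: algebra_simps)
    then have "- Im (z0 * deriv F z0) = 0"
    proof (rule DERIV_local_min[OF _ zero_less_one], intro allI impI)
      fix s :: real
      have "v z0 \<le> v (z0 * cis s)"
        by (rule z0(2)) (use z0(1) in \<open>auto simp: norm_mult\<close>)
      then show "Re (F (z0 * cis 0)) \<le> Re (F (z0 * cis s))"
        by (simp add: v_def norm_mult)
    qed
    then have "Im (\<phi> (\<omega> z0)) = 0"
      using F'[OF z0D] by simp
    then have "\<phi> (cnj (\<omega> z0)) = \<phi> (\<omega> z0)"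
      using cnj[of "\<omega> z0"] \<omega>[OF z0D] z0D by (auto simp: complex_eq_iff)
    then have "cnj (\<omega> z0) = \<omega> z0"
      using inj_onD[OF inj] \<omega>[OF z0D] z0D by auto
    then obtain x where x: "\<omega> z0 = of_real x"
      by (metis Reals_cases Reals_cnj_iff)
    then have "Re (\<phi> (- of_real \<rho>)) \<le> Re (\<phi> (\<omega> z0))"
      using \<omega>[OF z0D] mono[of x \<rho>] \<rho> by (simp add: \<rho>_def)
    then have low: "Re (- of_real \<rho> * deriv H (- of_real \<rho>)) \<le> Re (z0 * deriv F z0)"
      using F'[OF z0D] H'[of "- of_real \<rho>"] \<rho> \<rho>0 by simp
    have "((\<lambda>w. F (w * z0)) has_field_derivative deriv F z0 * z0) (at (of_real 1))"
      by (rule DERIV_chain2[of F]) (use dF in \<open>auto intro!: derivative_eq_intros\<close>)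
    then have vd1: "((\<lambda>t. F (of_real t * z0)) has_vector_derivative z0 * deriv F z0) (at 1)"
      by (drule_tac has_vector_derivative_real_field) (simp add: mult_ac)
    have "((\<lambda>w. H (- (w * of_real \<rho>))) has_field_derivative deriv H (- of_real \<rho>) * - of_real \<rho>) (at (of_real 1))"
      by (rule DERIV_chain2[of H]) (use dH in \<open>auto intro!: derivative_eq_intros\<close>)
    then have vd2: "((\<lambda>t. H (- of_real (t * \<rho>))) has_vector_derivative - of_real \<rho> * deriv H (- of_real \<rho>)) (at 1)"
      by (drule_tac has_vector_derivative_real_field) (simp add: mult_ac)
    \<comment> \<open>This is \<open>v\<close> along the ray through \<open>z0\<close>. A positive
      derivative at 1 gives points closer to the origin with smaller \<open>v\<close>.\<close>
    define p where "p t = Re (F (of_real t * z0)) - Re (H (- of_real (t * \<rho>))) + e * (t * \<rho>)" for t :: real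
    have "(p has_real_derivative
            Re (z0 * deriv F z0) - Re (- of_real \<rho> * deriv H (- of_real \<rho>)) + e * \<rho>) (at 1)"
      unfolding p_def
      by (rule derivative_eq_intros
            bounded_linear.has_vector_derivative[OF bounded_linear_Re vd1,
              folded has_real_derivative_iff_has_vector_derivative]
            bounded_linear.has_vector_derivative[OF bounded_linear_Re vd2,
              folded has_real_derivative_iff_has_vector_derivative] refl)+ simp
    moreover have "0 < Re (z0 * deriv F z0) - Re (- of_real \<rho> * deriv H (- of_real \<rho>)) + e * \<rho>"
      using low mult_pos_pos[OF \<open>e > 0\<close> \<rho>0] by linarith
    ultimately obtain d where d: "d > 0" "\<And>h. 0 < h \<Longrightarrow> h < d \<Longrightarrow> p (1 - h) < p 1"
      using DERIV_pos_inc_left by blast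
    \<comment> \<open>Capping the decrement at 1/2 keeps \<open>t\<close> positive, so that
      \<open>p t\<close> is \<open>v\<close> at \<open>t z0\<close>.\<close>
    define t where "t = 1 - min (d/2) (1/2)"
    have t: "0 < t" "t < 1" and "p t < p 1"
      using d(1) d(2)[of "min (d/2) (1/2)"] by (auto simp: t_def)
    have pv: "p s = v (of_real s * z0)" if "s > 0" for s
      using that by (simp add: p_def v_def \<rho>_def norm_mult)
    have "t * cmod z0 \<le> 1 * cmod z0"
      by (intro mult_right_mono) (use t in auto)
    then have "v z0 \<le> v (of_real t * z0)"
      using t z0(1) by (intro z0(2)) (auto simp: norm_mult)
    then show False
      using pv[of t] pv[of 1] t \<open>p t < p 1\<close> by simp
  qed
  then have "0 \<le> v z"
    using z0(2)[of z] F(2) H(2) by (simp add: R_def v_def)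
  moreover have "e * cmod z \<le> e * 1"
    using \<open>e > 0\<close> z by (intro mult_left_mono) auto
  ultimately show "Re (H (- of_real (cmod z))) \<le> Re (F z) + e"
    by (simp add: v_def)
qed

section \<open>The boundary of the image\<close>

text \<open>Otherwise the inverse would be a bounded entire function, hence constant by Liouville.
  This is what makes the frontier of the image nonempty.\<close>

lemma holomorphic_inj_image_disc_neq_UNIV:
  assumes f: "f holomorphic_on unit_disc" "inj_on f unit_disc"
  shows "f ` unit_disc \<noteq> UNIV"
proof
  assume UNIV: "f ` unit_disc = UNIV"
  obtain g where g: "g holomorphic_on f ` unit_disc" "\<forall>z\<in>unit_disc. g (f z) = z"
    by (rule holomorphic_has_inverse[OF f(1) open_ball f(2)], rule that) blast+
  have "g w \<in> unit_disc" for w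
  proof -
    have "w \<in> f ` unit_disc" using UNIV by simp
    then obtain z where "z \<in> unit_disc" "w = f z" by (rule imageE)
    then show ?thesis using g(2) by simp
  qed
  then have "range g \<subseteq> unit_disc" by (rule image_subsetI)
  then have "bounded (range g)"
    by (rule bounded_subset[OF bounded_ball])
  then have "g constant_on UNIV"
    using g(1) unfolding UNIV by (intro Liouville_theorem)
  then have "g (f 0) = g (f (1/2))"
    unfolding constant_on_def by (elim exE) simp
  moreover have "g (f 0) = 0" "g (f (1/2)) = 1/2"
    using g(2) by simp_all
  ultimately show False by simp
qed

text \<open>Values of modulus below \<open>\<kappa> R\<close> are attained only in the compact disc
  of radius \<open>R\<close>. A frontier point of such modulus would be a limit of these values,
  hence itself a value, while the open image misses its frontier.\<close>

lemma frontier_image_disc_ge: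
  fixes f :: "complex \<Rightarrow> complex" and \<kappa> :: "real \<Rightarrow> real"
  assumes f: "continuous_on unit_disc f" "open (f ` unit_disc)"
    and lower: "\<And>z. z \<in> unit_disc \<Longrightarrow> \<kappa> (cmod z) \<le> cmod (f z)"
    and mono: "mono_on {0..<1} \<kappa>"
    and w: "w \<in> frontier (f ` unit_disc)" and R: "0 \<le> R" "R < 1"
  shows "\<kappa> R \<le> cmod w"
proof (rule ccontr)
  assume "\<not> \<kappa> R \<le> cmod w"
  then have wb: "w \<in> ball 0 (\<kappa> R)" by simp
  have sub: "cball 0 R \<subseteq> unit_disc" using R by auto
  have "compact (f ` cball 0 R)"
    using f(1) sub by (intro compact_continuous_image) (auto intro: continuous_on_subset)
  then have cl: "closed (f ` cball 0 R)" by (rule compact_imp_closed)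
  have "f ` unit_disc \<inter> ball 0 (\<kappa> R) \<subseteq> f ` cball 0 R"
  proof
    fix y assume "y \<in> f ` unit_disc \<inter> ball 0 (\<kappa> R)"
    then obtain z where z: "z \<in> unit_disc" "y = f z" "cmod (f z) < \<kappa> R" by auto
    have "cmod z < R"
    proof (rule ccontr)
      assume "\<not> cmod z < R"
      then have "\<kappa> R \<le> \<kappa> (cmod z)"
        using mono_onD[OF mono, of R "cmod z"] R z by auto
      then show False using lower[OF z(1)] z(3) by simp
    qed
    then show "y \<in> f ` cball 0 R" using z by auto
  qed
  then have "closure (f ` unit_disc \<inter> ball 0 (\<kappa> R)) \<subseteq> f ` cball 0 R"
    using cl closure_minimal by blast
  moreover have "w \<in> closure (f ` unit_disc \<inter> ball 0 (\<kappa> R))"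
  proof -
    have "w \<in> ball 0 (\<kappa> R) \<inter> closure (f ` unit_disc)"
      using w wb unfolding frontier_def by blast
    then show ?thesis
      using open_Int_closure_subset[OF open_ball] by (subst Int_commute) (rule subsetD)
  qed
  ultimately have "w \<in> f ` unit_disc" using sub by blast
  then show False
    using w f(2) by (simp add: frontier_def interior_open)
qed

section \<open>The extremal function on the real diameter\<close>

locale ma_minda_extremal =
  fixes \<phi> h :: "complex \<Rightarrow> complex" and B :: "nat \<Rightarrow> real"
  assumes ma_minda: "ma_minda \<phi>"
    and taylor: "\<And>z. z \<in> unit_disc \<Longrightarrow>
           (\<lambda>n. of_real (B (Suc n)) * z ^ Suc n) sums (\<phi> z - 1)"
    and B_pos: "\<And>n. n \<ge> 1 \<Longrightarrow> B n > 0"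
    and h_class_S: "h \<in> class_S"
    and zlogderiv_h: "\<And>z. z \<in> unit_disc \<Longrightarrow> zlogderiv h z = \<phi> z"
begin

lemma phi_simps: "\<phi> holomorphic_on unit_disc" "inj_on \<phi> unit_disc" "\<phi> 0 = 1"
  and Re_phi_pos: "z \<in> unit_disc \<Longrightarrow> Re (\<phi> z) > 0"
  and deriv_phi: "deriv \<phi> 0 \<in> \<real>" "Re (deriv \<phi> 0) > 0"
  using ma_minda by (auto simp: ma_minda_def)

text \<open>Conjugation passes through the power series because its coefficients are real.\<close>

lemma phi_cnj: "z \<in> unit_disc \<Longrightarrow> \<phi> (cnj z) = cnj (\<phi> z)"
proof -
  assume z: "z \<in> unit_disc"
  have "(\<lambda>n. cnj (of_real (B (Suc n)) * z ^ Suc n)) sums cnj (\<phi> z - 1)"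
    using taylor[OF z] unfolding sums_cnj .
  then have "(\<lambda>n. of_real (B (Suc n)) * cnj z ^ Suc n) sums (cnj (\<phi> z) - 1)"
    by simp
  moreover have "(\<lambda>n. of_real (B (Suc n)) * cnj z ^ Suc n) sums (\<phi> (cnj z) - 1)"
    using z by (intro taylor) simp
  ultimately show ?thesis using sums_unique2 by fastforce
qed

lemma phi_real: "\<bar>x\<bar> < 1 \<Longrightarrow> Im (\<phi> (of_real x)) = 0"
  using phi_cnj[of "of_real x"] by (simp add: complex_eq_iff)

lemma phi_real_sums:
  assumes "\<bar>x\<bar> < 1"
  shows "(\<lambda>n. B (Suc n) * x ^ Suc n) sums (Re (\<phi> (of_real x)) - 1)"
proof -
  have "(\<lambda>n. complex_of_real (B (Suc n) * x ^ Suc n)) sums (\<phi> (of_real x) - 1)"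
    using taylor[of "of_real x"] assms by simp
  from sums_Re[OF this] show ?thesis by simp
qed

lemma phi_gt_1:
  assumes "0 < x" "x < 1"
  shows "Re (\<phi> (of_real x)) > 1"
proof -
  have s: "(\<lambda>n. B (Suc n) * x ^ Suc n) sums (Re (\<phi> (of_real x)) - 1)"
    using assms by (intro phi_real_sums) auto
  have "0 < (\<Sum>n. B (Suc n) * x ^ Suc n)"
    using assms B_pos by (intro suminf_pos sums_summable[OF s]) (auto intro!: mult_pos_pos)
  then show ?thesis using sums_unique[OF s] by simp
qed

text \<open>On the diameter \<open>\<phi>\<close> is real, continuous and injective, hence strictly
  monotone. Both directions are left open here; \<open>phi_gt_1\<close> decides between
  them.\<close>

lemma phi_real_between:
  assumes x: "-1 < a" "a < x" "x < b" "b < 1"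
  shows "(Re (\<phi> (of_real a)) < Re (\<phi> (of_real x)) \<and> Re (\<phi> (of_real x)) < Re (\<phi> (of_real b)))
       \<or> (Re (\<phi> (of_real b)) < Re (\<phi> (of_real x)) \<and> Re (\<phi> (of_real x)) < Re (\<phi> (of_real a)))"
proof (rule continuous_inj_imp_mono[OF x(2,3)])
  show "continuous_on {a..b} (\<lambda>x. Re (\<phi> (of_real x)))"
    by (intro continuous_intros
        continuous_on_compose2[OF holomorphic_on_imp_continuous_on[OF phi_simps(1)]]) (use x in auto)
  show "inj_on (\<lambda>x. Re (\<phi> (of_real x))) {a..b}"
  proof (rule inj_onI)
    fix s t assume st: "s \<in> {a..b}" "t \<in> {a..b}" "Re (\<phi> (of_real s)) = Re (\<phi> (of_real t))"
    then have "\<phi> (of_real s) = \<phi> (of_real t)"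
      using phi_real[of s] phi_real[of t] x by (auto simp: complex_eq_iff)
    then have "complex_of_real s = of_real t"
      by (rule inj_onD[OF phi_simps(2)]) (use st x in auto)
    then show "s = t" by simp
  qed
qed

text \<open>As \<open>\<phi> 0 = 1\<close> lies below the value at \<open>-x\<close>, the decreasing
  alternative is excluded.\<close>

lemma phi_lt_1:
  assumes "-1 < x" "x < 0"
  shows "Re (\<phi> (of_real x)) < 1"
  using phi_real_between[of x 0 "-x"] phi_gt_1[of "-x"] assms phi_simps(3) by auto

lemma phi_min_real:
  assumes "\<bar>x\<bar> \<le> \<rho>" "\<rho> < 1"
  shows "Re (\<phi> (- of_real \<rho>)) \<le> Re (\<phi> (of_real x))"
proof (cases "\<bar>x\<bar> = \<rho>")
  case True
  then consider "x = - \<rho>" | "x = \<rho>" "\<rho> > 0" by linarith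
  then show ?thesis
    using phi_lt_1[of "-\<rho>"] phi_gt_1[of "\<rho>"] assms by cases auto
next
  case False
  then have "- \<rho> < x" "x < \<rho>" "0 < \<rho>" using assms by linarith+
  then show ?thesis
    using phi_real_between[of "-\<rho>" x \<rho>] phi_lt_1[of "-\<rho>"] phi_gt_1[of \<rho>] assms by auto
qed

text \<open>The branch of log(h(z)/z) that vanishes at 0.\<close>

definition H where
  "H = (SOME H. H holomorphic_on unit_disc \<and> H 0 = 0 \<and>
          (\<forall>z\<in>unit_disc. h z = z * exp (H z) \<and> z * deriv H z = zlogderiv h z - 1))"

lemma H: "H holomorphic_on unit_disc" "H 0 = 0"
  and h_eq: "z \<in> unit_disc \<Longrightarrow> h z = z * exp (H z)"
  and deriv_H: "z \<in> unit_disc \<Longrightarrow> z * deriv H z = \<phi> z - 1"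
  using someI_ex[OF class_S_exp_representation[OF h_class_S], folded H_def] zlogderiv_h by simp_all

text \<open>The equation \<open>z H' = \<phi> - 1\<close> determines \<open>H'\<close> at 0 only
  after being differentiated there.\<close>

lemma deriv_H_0: "deriv H 0 = deriv \<phi> 0"
proof -
  have "deriv H holomorphic_on unit_disc"
    using H(1) by (intro holomorphic_deriv) auto
  then have "(deriv H has_field_derivative deriv (deriv H) 0) (at 0)"
    by (auto intro: holomorphic_derivI)
  then have "((\<lambda>z. z * deriv H z + 1) has_field_derivative deriv H 0) (at 0)"
    by (auto intro!: derivative_eq_intros)
  then have "(\<phi> has_field_derivative deriv H 0) (at 0)"
    by (rule has_field_derivative_transform_within_open[of _ _ _ unit_disc]) (use deriv_H in auto)
  then show ?thesis using DERIV_imp_deriv by metis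
qed

lemma deriv_H_real:
  assumes x: "\<bar>x\<bar> < 1"
  shows "Im (deriv H (of_real x)) = 0" "Re (deriv H (of_real x)) > 0"
    and "x * Re (deriv H (of_real x)) = Re (\<phi> (of_real x)) - 1"
proof -
  have eq: "of_real x * deriv H (of_real x) = \<phi> (of_real x) - 1"
    using deriv_H[of "of_real x"] x by simp
  from arg_cong[OF eq, of Im] have im: "x * Im (deriv H (of_real x)) = 0"
    using phi_real[OF x] by simp
  from arg_cong[OF eq, of Re] show re: "x * Re (deriv H (of_real x)) = Re (\<phi> (of_real x)) - 1"
    by simp
  show "Im (deriv H (of_real x)) = 0"
    using im deriv_H_0 deriv_phi(1) by (cases "x = 0") (auto simp: complex_is_Real_iff)
  show "Re (deriv H (of_real x)) > 0"
  proof (cases x "0::real" rule: linorder_cases)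
    case less
    then have "x * Re (deriv H (of_real x)) < 0"
      using re phi_lt_1[of x] x by simp
    then show ?thesis using less by (simp add: mult_less_0_iff)
  next
    case equal
    then show ?thesis using deriv_H_0 deriv_phi(2) by simp
  next
    case greater
    then have "0 < x * Re (deriv H (of_real x))"
      using re phi_gt_1[of x] x by simp
    then show ?thesis using greater by (simp add: zero_less_mult_iff)
  qed
qed

lemma H_vector_derivative:
  assumes "\<bar>x\<bar> < 1"
  shows "((\<lambda>x. H (of_real x)) has_vector_derivative deriv H (of_real x)) (at x)"
  by (rule has_vector_derivative_real_field) (use H(1) assms in \<open>auto intro: holomorphic_derivI\<close>)

text \<open>Since \<open>H\<close> is real on the diameter (\<open>H_real\<close>), this is
  log(h(x)/x), extended by 0 at 0.\<close>

definition \<eta> where "\<eta> x = Re (H (of_real x))"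

lemma \<eta>_deriv:
  assumes "\<bar>x\<bar> < 1"
  shows "(\<eta> has_real_derivative Re (deriv H (of_real x))) (at x)"
  unfolding \<eta>_def[abs_def] has_real_derivative_iff_has_vector_derivative
  by (rule bounded_linear.has_vector_derivative[OF bounded_linear_Re H_vector_derivative[OF assms]])

lemma \<eta>_0: "\<eta> 0 = 0"
  by (simp add: \<eta>_def H)

lemma \<eta>_continuous: "continuous_on {-1<..<1} \<eta>"
  by (rule DERIV_continuous_on) (auto intro!: DERIV_subset[OF \<eta>_deriv])

lemma \<eta>_strict_mono:
  assumes "-1 < x" "x < y" "y < 1"
  shows "\<eta> x < \<eta> y"
proof (rule DERIV_pos_imp_increasing[OF assms(2)])
  fix t assume "x \<le> t" "t \<le> y"
  then have "\<bar>t\<bar> < 1" using assms by auto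
  then show "\<exists>d. (\<eta> has_real_derivative d) (at t) \<and> 0 < d"
    using \<eta>_deriv deriv_H_real(2) by blast
qed

lemma H_real:
  assumes "\<bar>x\<bar> < 1"
  shows "H (of_real x) = of_real (\<eta> x)"
proof -
  have "((\<lambda>x. Im (H (of_real x))) has_real_derivative 0) (at t)" if "t \<in> {-1<..<1}" for t :: real
  proof -
    have "\<bar>t\<bar> < 1" using that by auto
    then show ?thesis
      using bounded_linear.has_vector_derivative[OF bounded_linear_Im H_vector_derivative, of t]
        deriv_H_real(1)[of t] by (simp add: has_real_derivative_iff_has_vector_derivative)
  qed
  then have "Im (H (of_real x)) = Im (H (of_real 0))"
    by (intro DERIV_isconst3[of "-1" 1]) (use assms in auto)
  then show ?thesis by (simp add: \<eta>_def H complex_eq_iff)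
qed

lemma h_real: "\<bar>x\<bar> < 1 \<Longrightarrow> h (of_real x) = of_real (x * exp (\<eta> x))"
  using h_eq[of "of_real x"] by (simp add: H_real flip: exp_of_real)

text \<open>Equals -h(-x), the lower bound for the growth of \<open>f\<close>.\<close>

definition \<kappa> where "\<kappa> x = x * exp (\<eta> (- x))"

lemma h_minus_real: "\<bar>x\<bar> < 1 \<Longrightarrow> h (- of_real x) = - of_real (\<kappa> x)"
  using h_real[of "-x"] by (simp add: \<kappa>_def)

text \<open>The derivative at \<open>t\<close> is \<open>exp (\<eta> (- t))\<close> times the real
  part of \<open>\<phi>\<close> at \<open>-t\<close>, and \<open>\<phi>\<close> maps into the right
  half-plane.\<close>

lemma \<kappa>_mono:
  assumes "0 \<le> x" "x \<le> y" "y < 1"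
  shows "\<kappa> x \<le> \<kappa> y"
proof (rule DERIV_nonneg_imp_nondecreasing[OF assms(2)])
  fix t assume t: "x \<le> t" "t \<le> y"
  have "((\<lambda>x. \<eta> (- x)) has_real_derivative Re (deriv H (of_real (- t))) * (- 1)) (at t)"
    by (rule DERIV_chain2[OF \<eta>_deriv]) (use t assms in \<open>auto intro!: derivative_eq_intros\<close>)
  then have "(\<kappa> has_real_derivative exp (\<eta> (- t)) * (1 + (- t) * Re (deriv H (of_real (- t))))) (at t)"
    unfolding \<kappa>_def[abs_def] by (auto intro!: derivative_eq_intros simp: algebra_simps)
  moreover have "1 + (- t) * Re (deriv H (of_real (- t))) = Re (\<phi> (of_real (- t)))"
    using deriv_H_real(3)[of "- t"] t assms by simp
  moreover have "Re (\<phi> (of_real (- t))) > 0"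
    using t assms by (intro Re_phi_pos) auto
  ultimately show "\<exists>d. (\<kappa> has_real_derivative d) (at t) \<and> 0 \<le> d"
    by (metis exp_ge_zero less_imp_le mult_nonneg_nonneg)
qed

text \<open>A bounded monotone \<open>\<kappa>\<close> tends to its supremum \<open>L\<close>. The
  last clause records that \<open>L\<close> is the least upper bound, so that bounds on
  \<open>\<kappa>\<close> pass to \<open>L\<close>.\<close>

lemma value_at_minus_one_h:
  obtains L where "0 < L" "L < 1" "value_at_minus_one h = - of_real L"
    and "\<And>c. (\<And>R. 0 \<le> R \<Longrightarrow> R < 1 \<Longrightarrow> \<kappa> R \<le> c) \<Longrightarrow> L \<le> c"
proof -
  define L where "L = (SUP x\<in>{0..<1}. \<kappa> x)"
  have bound: "\<kappa> x \<le> exp (\<eta> (- (1/2)))" if x: "0 \<le> x" "x < 1" for x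
  proof -
    \<comment> \<open>The estimate \<open>\<eta> (- y) \<le> \<eta> (- (1/2))\<close> needs
      \<open>y \<ge> 1/2\<close>; smaller \<open>x\<close> are moved up by monotonicity of
      \<open>\<kappa>\<close>.\<close>
    define y where "y = max x (1/2)"
    have y: "1/2 \<le> y" "y < 1" "x \<le> y" using x by (auto simp: y_def)
    have "\<kappa> x \<le> \<kappa> y" using x y by (intro \<kappa>_mono) auto
    also have "\<dots> \<le> 1 * exp (\<eta> (- y))"
      unfolding \<kappa>_def using y by (intro mult_right_mono) auto
    also have "\<eta> (- y) \<le> \<eta> (- (1/2))"
    proof (cases "y = 1/2")
      case False
      then show ?thesis
        using \<eta>_strict_mono[of "-y" "-(1/2)"] y by simp
    next
      case True
      show ?thesis unfolding True by (rule order_refl)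
    qed
    finally show ?thesis by simp
  qed
  have bdd: "bdd_above (\<kappa> ` {0..<1})"
    using bound by (intro bdd_aboveI2) auto
  have up: "\<kappa> x \<le> L" if "0 \<le> x" "x < 1" for x
    unfolding L_def using that by (intro cSUP_upper bdd) auto
  have least: "L \<le> c" if "\<And>R. 0 \<le> R \<Longrightarrow> R < 1 \<Longrightarrow> \<kappa> R \<le> c" for c
    unfolding L_def using that by (intro cSUP_least) auto
  have "0 < \<kappa> (1/2)" by (simp add: \<kappa>_def)
  then have pos: "0 < L" using up[of "1/2"] by simp
  have "L \<le> exp (\<eta> (- (1/2)))" by (rule least) (rule bound)
  also have "\<dots> < 1" using \<eta>_strict_mono[of "-(1/2)" 0] \<eta>_0 by simp
  finally have lt: "L < 1" .
  have "(\<kappa> \<longlongrightarrow> L) (at_left 1)"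
  proof (rule increasing_tendsto)
    show "\<forall>\<^sub>F x in at_left 1. \<kappa> x \<le> L"
      using eventually_at_left_real[OF zero_less_one] by eventually_elim (use up in auto)
  next
    fix y assume "y < L"
    then obtain x0 where x0: "x0 \<in> {0..<1}" "y < \<kappa> x0"
      unfolding L_def using less_cSUP_iff[OF _ bdd] by auto
    have "\<forall>\<^sub>F x in at_left 1. x \<in> {x0<..<1}"
      using x0 by (intro eventually_at_left_real) auto
    then show "\<forall>\<^sub>F x in at_left 1. y < \<kappa> x"
    proof eventually_elim
      case (elim x)
      then show ?case
        using x0 \<kappa>_mono[of x0 x] by simp
    qed
  qed
  then have "((\<lambda>x. - complex_of_real (\<kappa> x)) \<longlongrightarrow> - of_real L) (at_left 1)"
    by (intro tendsto_intros)
  moreover have "\<forall>\<^sub>F x in at_left 1. - complex_of_real (\<kappa> x) = h (- of_real x)"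
    using eventually_at_left_real[OF zero_less_one] by eventually_elim (simp add: h_minus_real)
  ultimately have "((\<lambda>x. h (- of_real x)) \<longlongrightarrow> - of_real L) (at_left 1)"
    by (rule Lim_transform_eventually)
  then have "value_at_minus_one h = - of_real L"
    unfolding value_at_minus_one_def by (intro tendsto_Lim) auto
  then show thesis using that pos lt least by blast
qed

lemma h_real_strict_mono:
  assumes "0 \<le> x" "x < y" "y < 1"
  shows "x * exp (\<eta> x) < y * exp (\<eta> y)"
  using \<eta>_strict_mono[of x y] assms by (intro mult_strict_mono) auto

text \<open>On [0,1) the function \<open>h\<close> is \<open>x * exp (\<eta> x)\<close>. It is 0 at
  0 and at least \<open>L\<close> at \<open>L\<close>, because \<open>\<eta> L > 0\<close>, so the
  value \<open>L\<close> is taken in between; strict monotonicity rules out an earlier root.\<close>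

lemma smallest_root_exists:
  assumes L: "0 < L" "L < 1" "value_at_minus_one h = - of_real L"
  obtains x where "smallest_root_01 (\<lambda>r. h (of_real r) + value_at_minus_one h) x"
    and "0 < x" "x < 1" "x * exp (\<eta> x) = L"
proof -
  have "\<exists>x\<ge>0. x \<le> L \<and> x * exp (\<eta> x) = L"
  proof (rule IVT')
    show "0 * exp (\<eta> 0) \<le> L" using L by simp
    have "\<eta> 0 < \<eta> L" using L by (intro \<eta>_strict_mono) auto
    then show "L \<le> L * exp (\<eta> L)" using L \<eta>_0 by simp
    show "continuous_on {0..L} (\<lambda>x. x * exp (\<eta> x))"
      by (intro continuous_intros continuous_on_subset[OF \<eta>_continuous]) (use L in auto)
  qed (use L in auto)
  then obtain x where x: "0 \<le> x" "x \<le> L" "x * exp (\<eta> x) = L" by blast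
  then have x01: "0 < x" "x < 1" using L by (cases "x = 0"; simp)+
  have eq: "h (of_real y) + value_at_minus_one h = of_real (y * exp (\<eta> y) - L)" if "0 < y" "y < 1" for y
    using h_real[of y] that L(3) by simp
  have "smallest_root_01 (\<lambda>r. h (of_real r) + value_at_minus_one h) x"
    unfolding smallest_root_01_def
  proof (intro conjI allI impI x01)
    show "h (of_real x) + value_at_minus_one h = 0"
      unfolding eq[OF x01] using x(3) by simp
    fix y assume y: "0 < y \<and> y < x"
    then show "h (of_real y) + value_at_minus_one h \<noteq> 0"
      using eq[of y] h_real_strict_mono[of y x] x(3) x01 by (simp del: of_real_mult of_real_diff)
  qed
  then show thesis using that x01 x(3) by blast
qed

section \<open>Growth and coefficient bounds for \<open>f\<close>\<close>

text \<open>Exponentiates \<open>Re_log_lower_bound\<close>, with Schwarz's lemma supplying the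
  bound on \<open>\<omega>\<close>.\<close>

lemma \<kappa>_le_cmod:
  assumes f: "f \<in> ma_minda_starlike \<phi>" and z: "z \<in> unit_disc"
  shows "\<kappa> (cmod z) \<le> cmod (f z)"
proof -
  have S: "f \<in> class_S" and sub: "subordinate (zlogderiv f) \<phi>"
    using f by (auto simp: ma_minda_starlike_def)
  obtain \<omega> where \<omega>: "\<omega> holomorphic_on unit_disc" "\<omega> ` unit_disc \<subseteq> unit_disc" "\<omega> 0 = 0"
    "\<forall>z\<in>unit_disc. zlogderiv f z = \<phi> (\<omega> z)"
    using sub by (auto simp: subordinate_def)
  obtain F where F: "F holomorphic_on unit_disc" "F 0 = 0"
    "\<forall>z\<in>unit_disc. f z = z * exp (F z) \<and> z * deriv F z = zlogderiv f z - 1"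
    using class_S_exp_representation[OF S] by blast
  have no: "norm (\<omega> z) < 1" if "norm z < 1" for z
    using \<omega>(2) that by (auto simp: image_subset_iff)
  have "Re (H (- of_real (cmod z))) \<le> Re (F z)"
  proof (rule Re_log_lower_bound[OF F(1,2) _ H deriv_H _ phi_simps(2) phi_cnj phi_min_real z])
    show "z * deriv F z = \<phi> (\<omega> z) - 1" if "z \<in> unit_disc" for z
      using F(3) \<omega>(4) that by simp
    show "cmod (\<omega> z) \<le> cmod z" if "z \<in> unit_disc" for z
      using that by (intro Schwarz_Lemma(1)[OF \<omega>(1,3) no]) auto
  qed
  then have "\<kappa> (cmod z) \<le> cmod z * exp (Re (F z))"
    by (auto simp: \<kappa>_def \<eta>_def intro!: mult_left_mono)
  also have "\<dots> = cmod (f z)"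
    using F(3) z by (simp add: norm_mult)
  finally show ?thesis .
qed

text \<open>With positive coefficients the majorant is a partial sum of the convergent series for
  \<open>\<phi> x\<close>.\<close>

lemma fps_majorant_phi_le:
  assumes x: "0 \<le> x" "x < 1"
  shows "fps_majorant N x (fps_expansion \<phi> 0) \<le> Re (\<phi> (of_real x))"
proof -
  define A where "A = Abs_fps (\<lambda>n. if n = 0 then 1 else complex_of_real (B n))"
  have s: "(\<lambda>n. fps_nth A n * z ^ n) sums \<phi> z" if "z \<in> unit_disc" for z
    by (rule iffD1[OF sums_iff_shift'[of _ 1]]) (use taylor[OF that] in \<open>simp add: A_def\<close>)
  have "\<phi> has_fps_expansion A"
    by (rule has_fps_expansionI)
       (use eventually_nhds_in_open[of unit_disc 0] s in \<open>auto elim: eventually_mono\<close>)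
  then have A: "fps_expansion \<phi> 0 = A"
    by (rule fps_expansion_eqI)
  have p: "(\<lambda>n. B (Suc n) * x ^ Suc n) sums (Re (\<phi> (of_real x)) - 1)"
    using x by (intro phi_real_sums) auto
  have B0: "0 < B (Suc n)" for n by (rule B_pos) simp
  have "fps_majorant N x A = 1 + (\<Sum>n<N. B (Suc n) * x ^ Suc n)"
    using B0 by (simp add: fps_majorant_def A_def sum.atMost_shift less_imp_le)
  also have "\<dots> \<le> 1 + (Re (\<phi> (of_real x)) - 1)"
    unfolding sums_unique[OF p]
    using B0 x by (intro add_left_mono sum_le_suminf sums_summable[OF p]) (auto simp: less_imp_le)
  finally show ?thesis by (simp add: A)
qed

text \<open>An instance of \<open>fps_majorant_le_exp\<close> with \<open>e = H'\<close>: then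
  \<open>1 + x * e x\<close> is \<open>\<phi> x\<close>, which bounds the majorant of
  \<open>\<phi> \<circ> \<omega>\<close>.\<close>

lemma fps_majorant_starlike_le:
  assumes f: "f \<in> ma_minda_starlike \<phi>" and r: "0 \<le> r" "r \<le> 1 / 3"
  shows "fps_majorant (Suc N) r (fps_expansion f 0) \<le> r * exp (\<eta> r)"
proof -
  have S: "f \<in> class_S" and sub: "subordinate (zlogderiv f) \<phi>"
    using f by (auto simp: ma_minda_starlike_def)
  then have f': "f holomorphic_on unit_disc" "f 0 = 0" "deriv f 0 = 1" "inj_on f unit_disc"
    by (auto simp: class_S_def class_A_def)
  obtain \<omega> where \<omega>: "\<omega> holomorphic_on unit_disc" "\<omega> ` unit_disc \<subseteq> unit_disc" "\<omega> 0 = 0"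
    "\<forall>z\<in>unit_disc. zlogderiv f z = \<phi> (\<omega> z)"
    using sub by (auto simp: subordinate_def)
  let ?F = "fps_expansion f 0" and ?G = "fps_expansion \<phi> 0 oo fps_expansion \<omega> 0"
  have F: "f has_fps_expansion ?F"
    by (rule has_fps_expansion_fps_expansion[of unit_disc]) (use f' in auto)
  have G: "(\<phi> \<circ> \<omega>) has_fps_expansion ?G"
    by (intro has_fps_expansion_compose has_fps_expansion_fps_expansion[of unit_disc])
       (use phi_simps \<omega> in \<open>auto simp: fps_expansion_def\<close>)
  \<comment> \<open>Clearing the denominator makes the equation valid at 0 too, so it becomes an
    identity of formal series by uniqueness of expansions.\<close>
  have eq: "z * deriv f z = f z * (\<phi> \<circ> \<omega>) z" if z: "z \<in> unit_disc" for z
  proof (cases "z = 0")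
    case False
    then have "f z \<noteq> 0"
      using inj_onD[OF f'(4), of z 0] f'(2) z by auto
    moreover have "z * deriv f z / f z = \<phi> (\<omega> z)"
      using bspec[OF \<omega>(4) z] False by (simp add: zlogderiv_def)
    ultimately show ?thesis by (auto simp: field_simps)
  qed (simp add: f')
  have "\<forall>\<^sub>F z in nhds 0. z * deriv f z = f z * (\<phi> \<circ> \<omega>) z"
    using eventually_nhds_in_open[of unit_disc 0] by (rule eventually_mono) (auto intro: eq[simplified])
  then have "(\<lambda>z. z * deriv f z) has_fps_expansion ?F * ?G"
    by (rule has_fps_expansion_cong[OF _ refl, THEN iffD2])
       (rule has_fps_expansion_mult[OF F G])
  moreover have "(\<lambda>z. z * deriv f z) has_fps_expansion fps_X * fps_deriv ?F"
    by (intro fps_expansion_intros F)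
  ultimately have FG: "fps_X * fps_deriv ?F = ?F * ?G"
    by (rule fps_expansion_unique_complex[rotated])
  show ?thesis
  proof (rule fps_majorant_le_exp[where e = "\<lambda>x. Re (deriv H (of_real x))", OF _ _ FG])
    show "fps_nth ?F 0 = 0" "fps_nth ?F 1 = 1"
      using f' by (simp_all add: fps_expansion_def)
    fix x :: real and N assume x: "0 < x" "x < r"
    \<comment> \<open>Here \<open>x < r \<le> 1/3\<close> is used: Bohr's inequality bounds the
      majorant of \<open>\<omega>\<close> by \<open>x\<close> itself.\<close>
    have "fps_majorant N x ?G \<le> fps_majorant N x (fps_expansion \<phi> 0)"
      using x r by (intro fps_majorant_compose Bohr_inequality_Schwarz \<omega>) auto
    also have "\<dots> \<le> Re (\<phi> (of_real x))"
      using x r by (intro fps_majorant_phi_le) auto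
    also have "\<dots> = 1 + x * Re (deriv H (of_real x))"
      using deriv_H_real(3)[of x] x r by simp
    finally show "fps_majorant N x ?G \<le> 1 + x * Re (deriv H (of_real x))" .
    show "(\<eta> has_real_derivative Re (deriv H (of_real x))) (at x)"
      using x r by (intro \<eta>_deriv) auto
  next
    show "continuous_on {0..r} \<eta>"
      by (rule continuous_on_subset[OF \<eta>_continuous]) (use r in auto)
  qed (use \<eta>_0 r in auto)
qed

lemma infdist_frontier_ge:
  assumes f: "f \<in> ma_minda_starlike \<phi>" and L: "\<And>c. (\<And>R. 0 \<le> R \<Longrightarrow> R < 1 \<Longrightarrow> \<kappa> R \<le> c) \<Longrightarrow> L \<le> c"
  shows "L \<le> infdist (f 0) (frontier (f ` unit_disc))"
proof -
  have f': "f holomorphic_on unit_disc" "f 0 = 0" "inj_on f unit_disc"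
    using f by (auto simp: ma_minda_starlike_def class_S_def class_A_def)
  have cont: "continuous_on unit_disc f"
    using f'(1) by (rule holomorphic_on_imp_continuous_on)
  \<comment> \<open>Nonemptiness matters because \<open>infdist\<close> to the empty set is 0 by
    convention.\<close>
  have ne: "frontier (f ` unit_disc) \<noteq> {}"
    using holomorphic_inj_image_disc_neq_UNIV[OF f'(1,3)] by (intro frontier_not_empty) auto
  have "L \<le> dist (f 0) w" if w: "w \<in> frontier (f ` unit_disc)" for w
  proof (rule L)
    fix R :: real assume R: "0 \<le> R" "R < 1"
    have "\<kappa> R \<le> cmod w"
      by (rule frontier_image_disc_ge[OF cont _ \<kappa>_le_cmod[OF f] _ w R])
         (auto intro!: invariance_of_domain cont f' mono_onI \<kappa>_mono)
    then show "\<kappa> R \<le> dist (f 0) w" by (simp add: f')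
  qed
  then show ?thesis
    unfolding infdist_notempty[OF ne] by (intro cINF_greatest ne)
qed

end

theorem theorem2p1:
  fixes \<phi> h f :: "complex \<Rightarrow> complex"
    and B :: "nat \<Rightarrow> real"
    and a :: "nat \<Rightarrow> complex"
  assumes "ma_minda \<phi>"
    and "\<And>z. z \<in> unit_disc \<Longrightarrow>
           (\<lambda>n. of_real (B (Suc n)) * z ^ Suc n) sums (\<phi> z - 1)"
    and "\<And>n. n \<ge> 1 \<Longrightarrow> B n > 0"
    and "\<phi> \<in> hardy_space 2"
    and "h \<in> class_S"
    and "\<And>z. z \<in> unit_disc \<Longrightarrow> zlogderiv h z = \<phi> z"
    and "f \<in> ma_minda_starlike \<phi>"
    and "\<And>z. z \<in> unit_disc \<Longrightarrow>
           (\<lambda>n. a (n + 2) * z ^ (n + 2)) sums (f z - z)"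
  shows "\<exists>r\<^sub>f. smallest_root_01 (\<lambda>r. h (of_real r) + value_at_minus_one h) r\<^sub>f \<and>
           (\<forall>z. cmod z \<le> min r\<^sub>f (1 / 3) \<longrightarrow>
              cmod z + (\<Sum>n. cmod (a (n + 2)) * cmod z ^ (n + 2))
                \<le> infdist (f 0) (frontier (f ` unit_disc)))"
proof -
  interpret ma_minda_extremal \<phi> h B
    using assms(1,2,3,5,6) by (rule ma_minda_extremal.intro)
  obtain L where L: "0 < L" "L < 1" "value_at_minus_one h = - of_real L"
    and L_least: "\<And>c. (\<And>R. 0 \<le> R \<Longrightarrow> R < 1 \<Longrightarrow> \<kappa> R \<le> c) \<Longrightarrow> L \<le> c"
    by (rule value_at_minus_one_h) blast
  obtain rf where rf: "smallest_root_01 (\<lambda>r. h (of_real r) + value_at_minus_one h) rf"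
    "0 < rf" "rf < 1" "rf * exp (\<eta> rf) = L"
    by (rule smallest_root_exists[OF L]) blast
  define A where "A = Abs_fps (\<lambda>n. if n = 0 then 0 else if n = 1 then 1 else a n)"
  \<comment> \<open>The given series starts at degree 2; the shift by two restores the terms 0 and
    \<open>z\<close>.\<close>
  have s: "(\<lambda>n. fps_nth A n * z ^ n) sums f z" if "z \<in> unit_disc" for z
    by (rule iffD1[OF sums_iff_shift'[of _ 2]])
       (use assms(8)[OF that] in \<open>simp add: A_def numeral_2_eq_2\<close>)
  have "f has_fps_expansion A"
    by (rule has_fps_expansionI)
       (use eventually_nhds_in_open[of unit_disc 0] s in \<open>auto elim: eventually_mono\<close>)
  then have A: "fps_expansion f 0 = A"
    by (rule fps_expansion_eqI)
  have main: "cmod z + (\<Sum>n. cmod (a (n + 2)) * cmod z ^ (n + 2)) \<le> L"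
    if z: "cmod z \<le> min rf (1 / 3)" for z
  proof -
    define r where "r = cmod z"
    have r: "0 \<le> r" "r \<le> rf" "r \<le> 1 / 3" using z by (auto simp: r_def)
    have "r * exp (\<eta> r) \<le> rf * exp (\<eta> rf)"
      using h_real_strict_mono[of r rf] r rf(3) by (cases "r = rf") auto
    moreover have "fps_majorant (Suc N) r A = r + (\<Sum>n<N. cmod (a (n + 2)) * r ^ (n + 2))" for N
      unfolding fps_majorant_def lessThan_Suc_atMost[symmetric] sum.lessThan_Suc_shift
      by (simp add: A_def del: sum.lessThan_Suc)
    ultimately have partial: "(\<Sum>n<N. cmod (a (n + 2)) * r ^ (n + 2)) \<le> L - r" for N
      using fps_majorant_starlike_le[OF assms(7) r(1,3), of N] rf(4) unfolding A by simp
    \<comment> \<open>The uniform bound on partial sums of nonnegative terms yields convergence as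
      well as the bound on the sum.\<close>
    have "summable (\<lambda>n. cmod (a (n + 2)) * r ^ (n + 2))"
      by (rule summableI_nonneg_bounded[OF _ partial]) (use r in simp)
    then have "(\<Sum>n. cmod (a (n + 2)) * r ^ (n + 2)) \<le> L - r"
      by (rule suminf_le_const) (rule partial)
    then show ?thesis by (simp add: r_def)
  qed
  have "L \<le> infdist (f 0) (frontier (f ` unit_disc))"
    by (rule infdist_frontier_ge[OF assms(7)]) (rule L_least, simp)
  then show ?thesis
    using rf(1) main by (meson order_trans)
qed

end
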